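(* The total number of operations made by a sequence of $n$ consecutive calls to $\textsc{Update}$ of Algorithm A (described in the context) is $O\big(n(\max_t\log|X_t|+(\log\Delta/\varepsilon)\,k)\big)$.
   Context: Let $(\mathcal U,d)$ be a metric space, $X\subseteq\mathcal U$ finite, $k\ge1$ an integer. Each $p\in X$ has an arrival time $t_{\rm arr}(p)\in\mathbb N$ and a deletion time $t_{\rm del}(p)\in\mathbb N$ with $t_{\rm arr}(p)<t_{\rm del}(p)$; arrival times are pairwise distinct. The active set at time $t$ is $X_t=\{p\in X: t_{\rm arr}(p)\le t<t_{\rm del}(p)\}$. $d(p,C)=\min_{q\in C}d(p,q)$. Let $d_{\min},d_{\max}$ be the minimum and maximum distance between two distinct points of $X$ (assumed known), $\Delta=d_{\max}/d_{\min}$. Let $\varepsilon>0$, $\beta=\varepsilon/2$, and $\Gamma=\{(1+\beta)^i:\lfloor\log_{1+\beta}d_{\min}\rfloor\le i\le\lceil\log_{1+\beta}d_{\max}\rceil\}$. Algorithm A: for each $\gamma\in\Gamma$ it maintains an ordered list of centers $C^\gamma=(c_1,\dots,c_\ell)$, $\ell\le k$, disjoint clusters $D_1,\dots,D_\ell$ ($c_i\in D_i$; implemented as doubly linked lists with constant-time access from $Q$), and an unclustered set $U^\gamma$; all current points are also in a priority queue $Q$ (a heap) keyed by deletion time (ties by arrival time). For a cluster $D_i$, let $P_i=\{x\in D_i: t_{\rm del}(c_i)<t_{\rm del}(x)\}$ and $V_i=D_i\setminus P_i$ (their sizes are kept as counters). $\textsc{Update}(p,t)$: while the minimum deletion time in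 $Q$ is $\le t$, remove that point $q$ from $Q$ and call $\textsc{Delete}(q,\gamma)$ for all $\gamma\in\Gamma$; then, if $p\ne$ null, call $\textsc{Insert}(p,\gamma)$ for all $\gamma$ and insert $p$ into $Q$. It is called at each arrival ($t=t_{\rm arr}(p)$) or with $p=$ null to flush expired points. $\textsc{Insert}(p,\gamma)$: put $p$ into $D_i$ for the smallest $i$ with $d(p,c_i)\le2\gamma$; if none exists, then if $\ell<k$ make $p$ the new center $c_{\ell+1}$ with cluster $D_{\ell+1}=\{p\}$ and increment $\ell$, else put $p$ in $U^\gamma$. Then call $\textsc{Reclustering}(\gamma)$. $\textsc{Delete}(p,\gamma)$: if $p$ is not a center, remove it from $U^\gamma$ or its cluster. Otherwise $p=c_i$: for each $x\in D_i\setminus\{p\}$, insert $x$ into $D_j$ for the smallest $j>i$ with $d(x,c_j)\le2\gamma$; if none, then if $\ell<k$ make $x$ a new center $c_{\ell+1}$ and increment $\ell$, else put $x$ in $U^\gamma$. Remove $c_i$ and $D_i$, decrement $\ell$, reindex contiguously preserving order. If $U^\gamma\ne\emptyset$: pick $u\in U^\gamma$ with maximum $t_{\rm del}$, make it new center $c_{\ell+1}$ (increment $\ell$), and move into its cluster every $x\in U^\gamma$ with $d(x,u)\le2\gamma$. Then call $\textsc{Reclustering}(\gamma)$. $\textsc{Reclustering}(\gamma)$: let $i$ be the smallest index with $\sum_{j=i}^{\ell}|P_j|>|U^\gamma|+\sum_{j=i}^{\ell}|V_j|$; if none, return. Otherwise let $U'=U^\gamma\cup\bigcup_{j\ge i}D_j$,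 remove centers $c_j$ and clusters $D_j$ for $j\ge i$; for $j=i,\dots,k$: if $U'=\emptyset$ set $\ell=j-1$ and stop; else pick $u\in U'$ with maximum $t_{\rm del}$, remove it from $U'$, make it center $c_j$, and move from $U'$ into $D_j$ every $x$ with $d(x,u)\le2\gamma$ (if the loop completes, $\ell=k$). Finally set $U^\gamma=U'$. Operations are counted in a unit-cost model where a distance evaluation costs $O(1)$.
   Formalization: Equal deletion times are ordered by arrival time also in P_i and in choosing the maximum t_del (else false); the O-constant is uniform only for ε ≤ ε₀ and Δ ≥ Δ₀ > 1 (it fails at Δ = 1 or ε → ∞) and is chosen after the underlying type of points; the calls start from the empty structure. *)

theory Defs
  imports "HOL-Analysis.Analysis" "HOL-Library.Landau_Symbols"
begin

text \<open>
  The structure kept for one radius \<open>\<gamma>\<close>: the ordered list of pairs (center, cluster) and the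
  set of unclustered points.  Cluster indices are 0-based positions in that list.
\<close>

type_synonym 'a clustering = "('a \<times> 'a set) list \<times> 'a set"

text \<open>The priority queue (as the set of its elements) together with one structure per \<open>\<gamma>\<close>.\<close>

type_synonym 'a state = "'a set \<times> (real \<Rightarrow> 'a clustering)"

text \<open>
  \<open>heap_cost m\<close> is the number of operations of one insertion into, or extraction of the minimum
  from, a heap with \<open>m\<close> elements.  Two distinct points have to exist, since otherwise the
  minimum and the maximum distance are undefined.
\<close>

locale lifetime_clustering = Metric_space M d for M :: "'a set" and d +
  fixes X :: "'a set" and k :: nat and t_arr t_del :: "'a \<Rightarrow> nat" and \<epsilon> :: real
    and heap_cost :: "nat \<Rightarrow> nat"
  assumes X_subset: "X \<subseteq> M"
    and finite_X: "finite X"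
    and two_points: "\<exists>x\<in>X. \<exists>y\<in>X. x \<noteq> y"
    and k_pos: "k \<ge> 1"
    and arr_less_del: "\<And>p. p \<in> X \<Longrightarrow> t_arr p < t_del p"
    and arr_inj: "inj_on t_arr X"
    and eps_pos: "\<epsilon> > 0"
begin

text \<open>Where \<open>active t\<close> is empty, \<open>log 2 (card (active t))\<close> is \<open>0\<close> by the convention for \<open>ln 0\<close>.\<close>

definition active :: "nat \<Rightarrow> 'a set" where
  "active t = {p \<in> X. t_arr p \<le> t \<and> t < t_del p}"

definition d_min :: real where
  "d_min = Min {d x y | x y. x \<in> X \<and> y \<in> X \<and> x \<noteq> y}"

definition d_max :: real where
  "d_max = Max {d x y | x y. x \<in> X \<and> y \<in> X \<and> x \<noteq> y}"

definition aspect_ratio :: real where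
  "aspect_ratio = d_max / d_min"

definition \<beta> :: real where
  "\<beta> = \<epsilon> / 2"

definition \<Gamma> :: "real set" where
  "\<Gamma> = {(1 + \<beta>) powi i | i. \<lfloor>log (1 + \<beta>) d_min\<rfloor> \<le> i \<and> i \<le> \<lceil>log (1 + \<beta>) d_max\<rceil>}"

text \<open>
  The order of deletion times, with ties resolved by arrival time.  It is the order of the
  priority queue, and it is used for every comparison of deletion times between points, that is
  also for the sets \<open>P\<^sub>i\<close> and for the choice of a point of maximum deletion time.  If the deletion
  times are pairwise distinct, it is just \<open>t_del x < t_del y\<close>.  With ties, comparing only the
  values of \<open>t_del\<close> in these two places would make the running time bound false: if all points
  expire at the same time, then no \<open>P\<^sub>i\<close> would have elements and nothing would ever be reclustered.
\<close>

definition expires_before :: "'a \<Rightarrow> 'a \<Rightarrow> bool" where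
  "expires_before x y \<longleftrightarrow> t_del x < t_del y \<or> (t_del x = t_del y \<and> t_arr x < t_arr y)"

definition first_to_expire :: "'a \<Rightarrow> 'a set \<Rightarrow> bool" where
  "first_to_expire q S \<longleftrightarrow> q \<in> S \<and> (\<forall>x\<in>S. \<not> expires_before x q)"

definition last_to_expire :: "'a \<Rightarrow> 'a set \<Rightarrow> bool" where
  "last_to_expire u S \<longleftrightarrow> u \<in> S \<and> (\<forall>x\<in>S. \<not> expires_before u x)"

text \<open>The sets \<open>P\<^sub>i\<close> and \<open>V\<^sub>i\<close> of a pair \<open>(c\<^sub>i, D\<^sub>i)\<close>.\<close>

definition P_set :: "'a \<times> 'a set \<Rightarrow> 'a set" where
  "P_set = (\<lambda>(c, D). {x \<in> D. expires_before c x})"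

definition V_set :: "'a \<times> 'a set \<Rightarrow> 'a set" where
  "V_set cD = snd cD - P_set cD"

text \<open>
  The procedures return the number of performed operations along with the new state.  A distance
  evaluation, a step of a scan over points or centers, the move of a point between sets (with the
  update of the size counters), and a constant amount of bookkeeping count as one operation each.
  The procedures are relations, as the order in which the points of a set are traversed is
  left open.

  \<open>assign \<gamma> i x\<close> looks for a center for \<open>x\<close> among those at positions \<open>i, i + 1, \<dots>\<close>: it
  evaluates the distances to these centers up to and including the first one within \<open>2\<gamma>\<close>.
\<close>

definition assign :: "real \<Rightarrow> nat \<Rightarrow> 'a \<Rightarrow> 'a clustering \<Rightarrow> 'a clustering \<times> nat" where
  "assign \<gamma> i x = (\<lambda>(L, W).
     let near = (\<lambda>j. i \<le> j \<and> j < length L \<and> d x (fst (L ! j)) \<le> 2 * \<gamma>) in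
     if \<exists>j. near j then
       let j = (LEAST j. near j) in
         ((L[j := (fst (L ! j), insert x (snd (L ! j)))], W), (j - i + 1) + 1)
     else if length L < k then ((L @ [(x, {x})], W), (length L - i) + 1)
     else ((L, insert x W), (length L - i) + 1))"

primrec assign_list :: "real \<Rightarrow> nat \<Rightarrow> 'a list \<Rightarrow> 'a clustering \<Rightarrow> 'a clustering \<times> nat" where
  "assign_list \<gamma> i [] S = (S, 0)"
| "assign_list \<gamma> i (x # xs) S =
     (let (S', a) = assign \<gamma> i x S; (S'', b) = assign_list \<gamma> i xs S' in (S'', a + b))"

definition captured :: "real \<Rightarrow> 'a \<Rightarrow> 'a set \<Rightarrow> 'a set" where
  "captured \<gamma> u W = insert u {x \<in> W. d x u \<le> 2 * \<gamma>}"

text \<open>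
  If there are unclustered points, the last one to expire becomes a new center.  This takes one
  scan of the unclustered points for the maximum, one for the distances, and the moves.
\<close>

inductive promote :: "real \<Rightarrow> 'a clustering \<Rightarrow> 'a clustering \<Rightarrow> nat \<Rightarrow> bool" for \<gamma> where
  promote_none: "promote \<gamma> (L, {}) (L, {}) 1"
| promote_new: "last_to_expire u W \<Longrightarrow>
    promote \<gamma> (L, W) (L @ [(u, captured \<gamma> u W)], W - captured \<gamma> u W)
      (1 + 2 * card W + card (captured \<gamma> u W))"

text \<open>The loop of the reclustering procedure, with at most \<open>m\<close> remaining iterations.\<close>

inductive rebuild :: "real \<Rightarrow> nat \<Rightarrow> 'a clustering \<Rightarrow> 'a clustering \<Rightarrow> nat \<Rightarrow> bool" for \<gamma> where
  rebuild_done: "rebuild \<gamma> 0 S S 1"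
| rebuild_stop: "rebuild \<gamma> (Suc m) (L, {}) (L, {}) 1"
| rebuild_step: "W \<noteq> {} \<Longrightarrow> promote \<gamma> (L, W) S a \<Longrightarrow> rebuild \<gamma> m S S' b \<Longrightarrow>
    rebuild \<gamma> (Suc m) (L, W) S' (1 + a + b)"

definition unbalanced :: "'a clustering \<Rightarrow> nat \<Rightarrow> bool" where
  "unbalanced = (\<lambda>(L, W) i.
     (\<Sum>j = i..<length L. card (P_set (L ! j))) > card W + (\<Sum>j = i..<length L. card (V_set (L ! j))))"

text \<open>
  The index \<open>i\<close> is found with the suffix sums of the size counters in one pass over the list of
  clusters; collecting \<open>U'\<close> takes one move per point.
\<close>

inductive recluster :: "real \<Rightarrow> 'a clustering \<Rightarrow> 'a clustering \<Rightarrow> nat \<Rightarrow> bool" for \<gamma> where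
  recluster_none: "(\<And>i. \<not> unbalanced (L, W) i) \<Longrightarrow> recluster \<gamma> (L, W) (L, W) (length L + 1)"
| recluster_some: "unbalanced (L, W) i \<Longrightarrow> (\<And>j. j < i \<Longrightarrow> \<not> unbalanced (L, W) j) \<Longrightarrow>
    U' = W \<union> \<Union> (snd ` set (drop i L)) \<Longrightarrow> rebuild \<gamma> (k - i) (take i L, U') S a \<Longrightarrow>
    recluster \<gamma> (L, W) S ((length L + 1) + (length L - i) + card U' + a)"

inductive insert_point :: "real \<Rightarrow> 'a \<Rightarrow> 'a clustering \<Rightarrow> 'a clustering \<Rightarrow> nat \<Rightarrow> bool" for \<gamma> p where
  insert_pointI: "assign \<gamma> 0 p S = (S', a) \<Longrightarrow> recluster \<gamma> S' S'' b \<Longrightarrow>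
    insert_point \<gamma> p S S'' (1 + a + b)"

definition remove_point :: "'a \<Rightarrow> 'a clustering \<Rightarrow> 'a clustering" where
  "remove_point p = (\<lambda>(L, W). (map (\<lambda>(c, D). (c, D - {p})) L, W - {p}))"

text \<open>
  The description leaves open whether the final call of the reclustering procedure is also made
  when the deleted point is not a center, so both are allowed.  While the points of \<open>D\<^sub>i\<close> are
  reassigned, \<open>c\<^sub>i\<close> is still in the list and counts for its length; removing it and reindexing takes
  at most one operation per center.
\<close>

inductive delete_point :: "real \<Rightarrow> 'a \<Rightarrow> 'a clustering \<Rightarrow> 'a clustering \<Rightarrow> nat \<Rightarrow> bool" for \<gamma> p where
  delete_noncenter: "p \<notin> fst ` set L \<Longrightarrow> delete_point \<gamma> p (L, W) (remove_point p (L, W)) 2"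
| delete_noncenter_recluster: "p \<notin> fst ` set L \<Longrightarrow> recluster \<gamma> (remove_point p (L, W)) S a \<Longrightarrow>
    delete_point \<gamma> p (L, W) S (2 + a)"
| delete_center: "i < length L \<Longrightarrow> L ! i = (p, D) \<Longrightarrow> distinct xs \<Longrightarrow> set xs = D - {p} \<Longrightarrow>
    assign_list \<gamma> (Suc i) xs (L, W) = ((L', W'), a) \<Longrightarrow>
    promote \<gamma> (take i L' @ drop (Suc i) L', W') S b \<Longrightarrow>
    recluster \<gamma> S S' e \<Longrightarrow>
    delete_point \<gamma> p (L, W) S' (1 + a + length L' + b + e)"

text \<open>The while loop at the start of an update: each iteration first inspects the minimum of the queue.\<close>

inductive flush :: "nat \<Rightarrow> 'a state \<Rightarrow> 'a state \<Rightarrow> nat \<Rightarrow> bool" for t where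
  flush_done: "(\<And>q. q \<in> Q \<Longrightarrow> t < t_del q) \<Longrightarrow> flush t (Q, S) (Q, S) 1"
| flush_step: "first_to_expire q Q \<Longrightarrow> t_del q \<le> t \<Longrightarrow>
    (\<And>\<gamma>. \<gamma> \<in> \<Gamma> \<Longrightarrow> delete_point \<gamma> q (S \<gamma>) (S' \<gamma>) (a \<gamma>)) \<Longrightarrow>
    flush t (Q - {q}, S') s b \<Longrightarrow>
    flush t (Q, S) s (1 + heap_cost (card Q) + (\<Sum>\<gamma>\<in>\<Gamma>. 1 + a \<gamma>) + b)"

inductive update :: "'a option \<Rightarrow> nat \<Rightarrow> 'a state \<Rightarrow> 'a state \<Rightarrow> nat \<Rightarrow> bool" where
  update_null: "flush t s s' a \<Longrightarrow> update None t s s' (1 + a)"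
| update_point: "flush t s (Q, S) a \<Longrightarrow>
    (\<And>\<gamma>. \<gamma> \<in> \<Gamma> \<Longrightarrow> insert_point \<gamma> p (S \<gamma>) (S' \<gamma>) (b \<gamma>)) \<Longrightarrow>
    update (Some p) t s (insert p Q, S')
      (1 + a + (\<Sum>\<gamma>\<in>\<Gamma>. 1 + b \<gamma>) + heap_cost (card (insert p Q)))"

text \<open>\<open>updates calls s s' c\<close>: the calls can take the state \<open>s\<close> to \<open>s'\<close> with \<open>c\<close> operations in total.\<close>

inductive updates :: "('a option \<times> nat) list \<Rightarrow> 'a state \<Rightarrow> 'a state \<Rightarrow> nat \<Rightarrow> bool" where
  updates_Nil: "updates [] s s 0"
| updates_Cons: "update p t s s' a \<Longrightarrow> updates calls s' s'' b \<Longrightarrow>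
    updates ((p, t) # calls) s s'' (a + b)"

definition initial_state :: "'a state" where
  "initial_state = ({}, \<lambda>_. ([], {}))"

text \<open>
  The sequences of calls made from the start of the stream: in chronological order, with
  one call for each arrival (and none skipped), and with arbitrarily interspersed null calls.
\<close>

definition call_sequence :: "('a option \<times> nat) list \<Rightarrow> bool" where
  "call_sequence calls \<longleftrightarrow>
     sorted (map snd calls) \<and>
     (\<forall>(p, t) \<in> set calls. \<forall>x. p = Some x \<longrightarrow> x \<in> X \<and> t = t_arr x) \<and>
     (\<forall>i j. i < j \<longrightarrow> j < length calls \<longrightarrow> fst (calls ! i) \<noteq> None \<longrightarrow>
        fst (calls ! i) \<noteq> fst (calls ! j)) \<and>
     (\<forall>x\<in>X. \<forall>t\<in>set (map snd calls). t_arr x < t \<longrightarrow> (Some x, t_arr x) \<in> set calls)"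

end

end

theory Submission
  imports Defs
begin

text \<open>
  For each \<open>\<gamma>\<close> an amortized analysis bounds the cost of an insertion or deletion by \<open>O(k)\<close>.
  A reclustering at index \<open>i\<close> costs \<open>O(k)\<close> per affected point; more than half of these points lie in
  some \<open>P\<^sub>j\<close>, and afterwards no \<open>P\<^sub>j\<close> with \<open>j \<ge> i\<close> has elements, so it suffices that each point
  of a \<open>P\<^sub>j\<close> has \<open>\<Theta>(k)\<close> credits.  When a center \<open>c\<^sub>i\<close> expires, everything else in its cluster is in
  \<open>P\<^sub>i\<close> and is moved to later clusters, while the points of the clusters behind it gain one
  position.  Since the state was balanced, the number of points of \<open>P\<^sub>j\<close> with \<open>j \<ge> i\<close> is at most that
  of the unclustered points and those of \<open>V\<^sub>j\<close> with \<open>j \<ge> i\<close>.  The latter pay: each of them, except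
  \<open>c\<^sub>i\<close>, has just lost one of the at most \<open>k\<close> centers in front of it that expire before it, and this
  number never grows while the point stays where it is, since a new center is put at the end of the
  list.
\<close>

section \<open>Ordered partitions of a point set into clusters and unclustered points\<close>

text \<open>The set still to be distributed is passed along the list. This gives disjointness
  without a separate clause and lets a partition be cut at any position, the two halves sharing one
  intermediate set.\<close>

fun ordered_partition :: "'a set \<Rightarrow> ('a \<times> 'a set) list \<Rightarrow> 'a set \<Rightarrow> bool" where
  "ordered_partition Q [] W \<longleftrightarrow> W = Q"
| "ordered_partition Q ((c, D) # L) W \<longleftrightarrow> c \<in> D \<and> D \<subseteq> Q \<and> ordered_partition (Q - D) L W"

lemma ordered_partition_append:
  "ordered_partition Q (A @ R) W \<longleftrightarrow> (\<exists>T. ordered_partition Q A T \<and> ordered_partition T R W)"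
  by (induction A arbitrary: Q) auto

lemma ordered_partition_union:
  "ordered_partition Q L W \<Longrightarrow> Q = W \<union> \<Union> (snd ` set L)"
  by (induction Q L W rule: ordered_partition.induct) auto

lemma ordered_partition_subset:
  "ordered_partition Q L W \<Longrightarrow> W \<subseteq> Q"
  using ordered_partition_union by blast

lemma ordered_partition_center:
  "ordered_partition Q L W \<Longrightarrow> (c, D) \<in> set L \<Longrightarrow> c \<in> D \<and> D \<subseteq> Q"
  by (induction Q L W rule: ordered_partition.induct) auto

lemma ordered_partition_enlarge:
  "ordered_partition Q L W \<Longrightarrow> S \<inter> Q = {} \<Longrightarrow> ordered_partition (Q \<union> S) L (W \<union> S)"
proof (induction Q L W rule: ordered_partition.induct)
  case (2 Q c D L W)
  have "Q \<union> S - D = (Q - D) \<union> S" using 2 by auto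
  with 2 show ?case by auto
qed simp

lemma ordered_partition_shrink:
  "ordered_partition Q L W \<Longrightarrow> S \<subseteq> W \<Longrightarrow> ordered_partition (Q - S) L (W - S)"
proof (induction Q L W rule: ordered_partition.induct)
  case (2 Q c D L W)
  have "W \<subseteq> Q - D" using 2 ordered_partition_subset[of "Q - D" L W] by auto
  moreover have "Q - S - D = Q - D - S" by auto
  ultimately show ?case using 2 by auto
qed simp

text \<open>The clusters of \<open>A\<close> are disjoint from \<open>D\<close>, so taking
  \<open>D\<close> out of the whole set affects only what \<open>A\<close> leaves over. This is the
  situation when the cluster of an expired center is dissolved.\<close>

lemma ordered_partition_remove_cluster:
  assumes "ordered_partition Q (A @ (p, D) # R) W"
  obtains T where "ordered_partition (Q - D) A T" "ordered_partition T R W"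
proof -
  from assms obtain T where T: "ordered_partition Q A T" "D \<subseteq> T" "ordered_partition (T - D) R W"
    by (auto simp: ordered_partition_append)
  show ?thesis using that ordered_partition_shrink T by blast
qed

lemma ordered_partition_remove:
  "ordered_partition Q L W \<Longrightarrow> p \<notin> fst ` set L \<Longrightarrow>
    ordered_partition (Q - {p}) (map (\<lambda>(c, D). (c, D - {p})) L) (W - {p})"
proof (induction Q L W rule: ordered_partition.induct)
  case (2 Q c D L W)
  have "Q - {p} - (D - {p}) = Q - D - {p}" by auto
  with 2 show ?case by auto
qed simp

lemma ordered_partition_insert_cluster:
  assumes "ordered_partition T (R1 @ (c, D) # R2) W" "x \<notin> T"
  shows "ordered_partition (insert x T) (R1 @ (c, insert x D) # R2) W"
proof -
  from assms obtain T' where T': "ordered_partition T R1 T'" "c \<in> D" "D \<subseteq> T'" "ordered_partition (T' - D) R2 W"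
    by (auto simp: ordered_partition_append)
  have "T' \<subseteq> T" using T'(1) ordered_partition_subset by auto
  then have "insert x T' - insert x D = T' - D" using assms by auto
  with T' ordered_partition_enlarge[OF T'(1), of "{x}"] assms show ?thesis
    by (auto simp: ordered_partition_append intro!: exI[of _ "insert x T'"])
qed

lemma ordered_partition_insert_center:
  assumes "ordered_partition T R W" "x \<notin> T"
  shows "ordered_partition (insert x T) (R @ [(x, {x})]) W"
proof -
  have "x \<notin> W" using assms ordered_partition_subset by auto
  with ordered_partition_enlarge[OF assms(1), of "{x}"] assms show ?thesis
    by (auto simp: ordered_partition_append intro!: exI[of _ "insert x W"])
qed

section \<open>Expiry order and cluster counters\<close>

context lifetime_clustering
begin

lemma finite_active: "finite (active t)"
  using finite_X by (auto simp: active_def)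

text \<open>Distinct arrival times resolve every tie. Totality is what later puts all other points
  of the cluster of an expiring center into its \<open>P_set\<close>.\<close>

lemma expires_before_total:
  "x \<in> X \<Longrightarrow> y \<in> X \<Longrightarrow> x \<noteq> y \<Longrightarrow> expires_before x y \<or> expires_before y x"
  using arr_inj unfolding expires_before_def inj_on_def by (metis nat_neq_iff)

lemma expires_before_irrefl [simp]: "\<not> expires_before x x"
  by (simp add: expires_before_def)

abbreviation P_total :: "('a \<times> 'a set) list \<Rightarrow> nat" where
  "P_total L \<equiv> \<Sum>cD\<leftarrow>L. card (P_set cD)"

abbreviation V_total :: "('a \<times> 'a set) list \<Rightarrow> nat" where
  "V_total L \<equiv> \<Sum>cD\<leftarrow>L. card (V_set cD)"

lemma finite_P_set [simp]: "finite (snd cD) \<Longrightarrow> finite (P_set cD)"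
  by (auto simp: P_set_def split: prod.splits)

lemma finite_V_set [simp]: "finite (snd cD) \<Longrightarrow> finite (V_set cD)"
  by (auto simp: V_set_def)

lemma P_set_insert:
  "P_set (c, insert x D) = (if expires_before c x then insert x (P_set (c, D)) else P_set (c, D))"
  by (auto simp: P_set_def)

lemma V_set_insert:
  "x \<notin> D \<Longrightarrow> V_set (c, insert x D) = (if expires_before c x then V_set (c, D) else insert x (V_set (c, D)))"
  by (auto simp: V_set_def P_set_def)

lemma P_set_remove: "P_set (c, D - {p}) = P_set (c, D) - {p}"
  by (auto simp: P_set_def)

lemma V_set_remove: "V_set (c, D - {p}) = V_set (c, D) - {p}"
  by (auto simp: V_set_def P_set_def)

lemma card_P_V:
  assumes "finite (snd cD)"
  shows "card (P_set cD) + card (V_set cD) = card (snd cD)"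
proof -
  have "P_set cD \<subseteq> snd cD" by (auto simp: P_set_def split: prod.splits)
  then show ?thesis
    using card_Diff_subset[of "P_set cD" "snd cD"] card_mono[of "snd cD" "P_set cD"] assms by (simp add: V_set_def)
qed

lemma ordered_partition_card:
  "ordered_partition Q L W \<Longrightarrow> finite Q \<Longrightarrow> card Q = P_total L + V_total L + card W"
proof (induction Q L W rule: ordered_partition.induct)
  case (2 Q c D L W)
  have D: "finite D" "D \<subseteq> Q" using 2 finite_subset by auto
  then have "card Q = card D + card (Q - D)"
    using card_Diff_subset[of D Q] card_mono[of Q D] 2 by simp
  with D show ?case using 2 card_P_V[of "(c, D)"] by auto
qed simp

section \<open>The potential of one clustering\<close>

definition earlier :: "'a list \<Rightarrow> 'a \<Rightarrow> nat" where
  "earlier C x = length (filter (\<lambda>c. expires_before c x) C)"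

lemma earlier_le: "earlier C x \<le> length C"
  by (simp add: earlier_def)

text \<open>
  The list \<open>C\<close> holds the centers in front of \<open>L\<close>.  A point of \<open>P\<^sub>j\<close> has saved up for one
  reclustering and for the centers behind its own, which it may still have to scan.  A point of
  \<open>V\<^sub>j\<close> or of the unclustered set pays a constant amount whenever a center in front of it expires.
\<close>

primrec potential :: "'a list \<Rightarrow> ('a \<times> 'a set) list \<Rightarrow> 'a set \<Rightarrow> nat" where
  "potential C [] W = 8 * (\<Sum>x\<in>W. earlier C x)"
| "potential C (cD # L) W = (24 * k + (k - length C)) * card (P_set cD)
     + 8 * (\<Sum>x\<in>V_set cD. earlier C x) + potential (fst cD # C) L W"

lemma potential_append:
  "potential C (A @ R) W = potential C A {} + potential (rev (map fst A) @ C) R W"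
  by (induction A arbitrary: C) auto

text \<open>Keeps only the reserve of \<open>24 * k\<close> per point of a \<open>P_set\<close>,
  which a reclustering may spend.\<close>

lemma potential_ge: "24 * k * P_total L \<le> potential C L W"
proof (induction L arbitrary: C)
  case (Cons cD L)
  show ?case using Cons[of "fst cD # C"] by (simp add: algebra_simps)
qed simp

text \<open>This bounds the potential after a rebuild: only the \<open>earlier\<close> terms remain,
  and none exceeds the number of centers in front.\<close>

lemma potential_no_P:
  assumes "\<forall>cD \<in> set L. P_set cD = {}" "length C + length L \<le> m"
  shows "potential C L W \<le> 8 * m * (V_total L + card W)"
  using assms
proof (induction L arbitrary: C)
  case Nil
  have "earlier C x \<le> m" for x using earlier_le[of C x] Nil by simp
  then show ?case using sum_bounded_above[of W "earlier C" m] by (simp add: mult.commute)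
next
  case (Cons cD L)
  have "earlier C x \<le> m" for x using earlier_le[of C x] Cons(3) by simp
  then have "(\<Sum>x\<in>V_set cD. earlier C x) \<le> card (V_set cD) * m"
    using sum_bounded_above[of "V_set cD" "earlier C" m] by simp
  then show ?case using Cons(1)[of "fst cD # C"] Cons(2,3) by (simp add: algebra_simps)
qed

lemma potential_remove:
  assumes "ordered_partition Q L W" "finite Q"
  shows "potential C (map (\<lambda>(c, D). (c, D - {p})) L) (W - {p}) \<le> potential C L W"
  using assms
proof (induction Q L W arbitrary: C rule: ordered_partition.induct)
  case (1 Q W)
  then show ?case by (simp add: sum_mono2)
next
  case (2 Q c D L W)
  then have D: "finite D" using finite_subset by auto
  have "card (P_set (c, D - {p})) \<le> card (P_set (c, D))"
    unfolding P_set_remove using D by (intro card_mono) auto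
  moreover have "(\<Sum>x\<in>V_set (c, D - {p}). earlier C x) \<le> (\<Sum>x\<in>V_set (c, D). earlier C x)"
    unfolding V_set_remove using D by (intro sum_mono2) auto
  ultimately show ?case using 2(1)[of "c # C"] 2 by (auto intro!: add_mono mult_le_mono2)
qed

text \<open>\<open>C'\<close> is \<open>C\<close> with one more center, which is about to expire before all points of \<open>Q\<close>.\<close>

lemma potential_shift:
  assumes "length C' = Suc (length C)" "\<And>x. x \<in> Q \<Longrightarrow> earlier C' x = Suc (earlier C x)"
    and "ordered_partition Q L W" "finite Q"
  shows "potential C L W + 8 * (V_total L + card W) \<le> potential C' L W + P_total L"
  using assms(3,1,2,4)
proof (induction Q L W arbitrary: C C' rule: ordered_partition.induct)
  case (1 Q W)
  then show ?case by (simp add: sum_Suc)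
next
  case (2 Q c D L W)
  have D: "finite D" "D \<subseteq> Q" using 2 finite_subset by auto
  have "V_set (c, D) \<subseteq> Q" using D by (auto simp: V_set_def)
  then have "(\<Sum>x\<in>V_set (c, D). earlier C' x) = (\<Sum>x\<in>V_set (c, D). Suc (earlier C x))"
    using 2 by (intro sum.cong) auto
  also have "\<dots> = (\<Sum>x\<in>V_set (c, D). earlier C x) + card (V_set (c, D))"
    by (simp add: sum_Suc)
  finally have V: "(\<Sum>x\<in>V_set (c, D). earlier C' x) = (\<Sum>x\<in>V_set (c, D). earlier C x) + card (V_set (c, D))" .
  \<comment> \<open>One center fewer in front raises the weight of a point of a \<open>P_set\<close>
    by at most one; with truncated subtraction this also holds if \<open>length C\<close> reaches
    \<open>k\<close>.\<close>
  have "24 * k + (k - length C) \<le> Suc (24 * k + (k - length C'))" using 2 by simp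
  then have P: "(24 * k + (k - length C)) * card (P_set (c, D)) \<le> (24 * k + (k - length C')) * card (P_set (c, D)) + card (P_set (c, D))"
    by (metis add.commute mult_Suc mult_le_mono1)
  have "potential (c # C) L W + 8 * (V_total L + card W) \<le> potential (c # C') L W + P_total L"
    using 2 by (intro 2(1)) (auto simp: earlier_def)
  then show ?case using P V by simp
qed

section \<open>Invariants of one clustering\<close>

text \<open>The last conjunct has two effects: \<open>assign\<close> opens a new center only when
  \<open>W\<close> is empty, and a promotion after the removal of a center never leads to more than
  \<open>k\<close> centers.\<close>

definition well_formed :: "'a set \<Rightarrow> 'a clustering \<Rightarrow> bool" where
  "well_formed Q = (\<lambda>(L, W). ordered_partition Q L W \<and> length L \<le> k \<and> (W \<noteq> {} \<longrightarrow> length L = k))"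

definition balanced :: "nat \<Rightarrow> 'a clustering \<Rightarrow> bool" where
  "balanced r = (\<lambda>(L, W). \<forall>i. P_total (drop i L) \<le> card W + V_total (drop i L) + r)"

definition pot :: "'a clustering \<Rightarrow> nat" where
  "pot = (\<lambda>(L, W). potential [] L W)"

text \<open>Links the index sums of \<open>unbalanced\<close> to sums over suffixes, which suit
  induction and \<open>append\<close>; for \<open>i\<close> beyond the list both sides are
  zero.\<close>

lemma sum_nth_drop: "(\<Sum>j = i..<length L. f (L ! j)) = (\<Sum>y\<leftarrow>drop i L. f y)"
proof -
  have "(\<Sum>y\<leftarrow>drop i L. f y) = (\<Sum>j = 0..<length L - i. f (L ! (i + j)))"
    by (auto simp: sum_list_sum_nth intro: sum.cong)
  also have "\<dots> = (\<Sum>j = i..<length L. f (L ! j))"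
    by (cases "i \<le> length L") (use sum.shift_bounds_nat_ivl[of "\<lambda>j. f (L ! j)" 0 i "length L - i"] in \<open>auto simp: add.commute\<close>)
  finally show ?thesis by simp
qed

lemma unbalanced_iff:
  "unbalanced (L, W) i \<longleftrightarrow> card W + V_total (drop i L) < P_total (drop i L)"
  unfolding unbalanced_def by (simp add: sum_nth_drop[of "\<lambda>x. card (P_set x)"] sum_nth_drop[of "\<lambda>x. card (V_set x)"])

section \<open>Assigning points to centers\<close>

text \<open>The skipped prefix \<open>A\<close> is split off because only the part behind it is
  scanned and changed. When a center is deleted, \<open>A\<close> ends with this very
  center.\<close>

lemma assign_cases:
  assumes "assign \<gamma> (length A) x (A @ R, W) = (S, a)"
  obtains (cluster) R1 c D R2 where "R = R1 @ (c, D) # R2" "S = (A @ R1 @ (c, insert x D) # R2, W)" "a = length R1 + 2"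
  | (center) "length (A @ R) < k" "S = (A @ R @ [(x, {x})], W)" "a = length R + 1"
  | (unclustered) "length (A @ R) \<ge> k" "S = (A @ R, insert x W)" "a = length R + 1"
proof -
  define near where "near j \<longleftrightarrow> length A \<le> j \<and> j < length (A @ R) \<and> d x (fst ((A @ R) ! j)) \<le> 2 * \<gamma>" for j
  note as = assms[unfolded assign_def prod.case Let_def, folded near_def]
  show ?thesis
  proof (cases "\<exists>j. near j")
    case True
    define j where "j = (LEAST j. near j)"
    have j: "near j" using True unfolding j_def by (rule LeastI_ex)
    obtain m where m: "j = length A + m" "m < length R" using j unfolding near_def
      by (metis add_less_cancel_left le_iff_add length_append)
    have eq: "S = ((A @ R)[j := (fst ((A @ R) ! j), insert x (snd ((A @ R) ! j)))], W)" "a = (j - length A + 1) + 1"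
      using as[folded j_def] True by auto
    obtain c D where cD: "R ! m = (c, D)" by (cases "R ! m")
    show ?thesis
    proof (rule cluster)
      show "R = take m R @ (c, D) # drop (Suc m) R" using m cD id_take_nth_drop by metis
      show "S = (A @ take m R @ (c, insert x D) # drop (Suc m) R, W)"
        using eq m cD by (simp add: list_update_append upd_conv_take_nth_drop nth_append)
      show "a = length (take m R) + 2" using eq m by simp
    qed
  next
    case False
    then show ?thesis using as center unclustered by (auto split: if_splits)
  qed
qed

text \<open>Each further center scanned lowers the weight of a point that ends in a
  \<open>P_set\<close> by one, so this scan pays for itself. Any other point receives at most
  \<open>8 * k\<close>, which leaves room for the scan. \<open>C\<close> may be shorter than
  \<open>A\<close>, since an expiring center is still listed but no longer counted.\<close>

lemma assign_potential:
  assumes "assign \<gamma> (length A) x (A @ R, W) = (S, a)"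
    and "length (A @ R) \<le> k" and "W \<noteq> {} \<longrightarrow> length (A @ R) = k"
    and part: "ordered_partition T R W" and fin: "finite T" and x: "x \<notin> T" and C: "length C \<le> length A"
  obtains R' W' where "S = (A @ R', W')" "length (A @ R') \<le> k" "W' \<noteq> {} \<longrightarrow> length (A @ R') = k"
    "ordered_partition (insert x T) R' W'" "card W' \<le> Suc (card W)"
    "a + potential C R' W' \<le> potential C R W + (24 * k + (k - length C) + 2)"
  using assms(1)
proof (cases rule: assign_cases)
  case (cluster R1 c D R2)
  let ?C = "rev (map fst R1) @ C"
  have D: "D \<subseteq> T" using part ordered_partition_center cluster by fastforce
  then have "finite D" and xD: "x \<notin> D" using fin x finite_subset by auto
  then have finD: "finite (P_set (c, D))" "finite (V_set (c, D))" by auto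
  have xPV: "x \<notin> P_set (c, D)" "x \<notin> V_set (c, D)" using xD by (auto simp: P_set_def V_set_def)
  have le: "length R1 + length C \<le> k" using assms(2) cluster C by simp
  have "earlier ?C x \<le> k" using le earlier_le[of ?C x] by simp
  define w where "w = 24 * k + (k - (length R1 + length C))"
  have pot: "potential C (R1 @ (c, D') # R2) W = w * card (P_set (c, D'))
      + 8 * (\<Sum>x\<in>V_set (c, D'). earlier ?C x) + (potential C R1 {} + potential (c # ?C) R2 W)" for D'
    by (simp add: potential_append[of C R1] w_def)
  have "w * card (P_set (c, insert x D)) + 8 * (\<Sum>x\<in>V_set (c, insert x D). earlier ?C x)
      \<le> w * card (P_set (c, D)) + 8 * (\<Sum>x\<in>V_set (c, D). earlier ?C x) + (if expires_before c x then w else 8 * k)"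
    using finD xPV xD \<open>earlier ?C x \<le> k\<close> by (simp add: P_set_insert V_set_insert)
  moreover have "(if expires_before c x then w else 8 * k) + a \<le> 24 * k + (k - length C) + 2"
    using le cluster(3) by (cases "expires_before c x") (simp_all add: w_def)
  ultimately have "a + potential C (R1 @ (c, insert x D) # R2) W \<le> potential C R W + (24 * k + (k - length C) + 2)"
    unfolding cluster(1) pot by linarith
  moreover have "ordered_partition (insert x T) (R1 @ (c, insert x D) # R2) W"
    using part x unfolding cluster by (rule ordered_partition_insert_cluster)
  ultimately show ?thesis using that[of "R1 @ (c, insert x D) # R2" W] cluster assms by simp
next
  case center
  let ?C = "rev (map fst R) @ C"
  \<comment> \<open>Since \<open>W\<close> is empty, appending the center raises no
    \<open>earlier\<close> count of an existing point.\<close>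
  have W: "W = {}" using center assms by auto
  have PV: "P_set (x, {x}) = {}" "V_set (x, {x}) = {x}" by (auto simp: P_set_def V_set_def)
  have "earlier ?C x \<le> k" using center C earlier_le[of ?C x] by simp
  then have "a + potential C (R @ [(x, {x})]) W \<le> potential C R W + (24 * k + (k - length C) + 2)"
    using center W PV C by (simp add: potential_append[of C R])
  moreover have "ordered_partition (insert x T) (R @ [(x, {x})]) W"
    using part x by (rule ordered_partition_insert_center)
  ultimately show ?thesis using that[of "R @ [(x, {x})]" W] center W by simp
next
  case unclustered
  let ?C = "rev (map fst R) @ C"
  have W: "x \<notin> W" "finite W" using ordered_partition_subset[OF part] x fin finite_subset by auto
  have pot: "potential C R W' = potential C R {} + 8 * (\<Sum>x\<in>W'. earlier ?C x)" for W'
    using potential_append[of C R "[]" W'] by simp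
  have "a + 8 * earlier ?C x \<le> 24 * k + (k - length C) + 2"
    using unclustered assms(2) C earlier_le[of ?C x] by simp
  then have "a + potential C R (insert x W) \<le> potential C R W + (24 * k + (k - length C) + 2)"
    using W pot[of W] pot[of "insert x W"] by simp
  moreover have "ordered_partition (insert x T) R (insert x W)"
    using ordered_partition_enlarge[OF part, of "{x}"] x by simp
  ultimately show ?thesis using that[of R "insert x W"] unclustered assms W by simp
qed

text \<open>The bound on \<open>card W'\<close> serves the cost of the \<open>promote\<close> that
  follows in a deletion.\<close>

lemma assign_list_potential:
  assumes "assign_list \<gamma> (length A) xs (A @ R, W) = (S, a)"
    and "length (A @ R) \<le> k" and "W \<noteq> {} \<longrightarrow> length (A @ R) = k"
    and "ordered_partition T R W" and "finite T" and "set xs \<inter> T = {}" and "distinct xs" and "length C \<le> length A"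
  shows "\<exists>R' W'. S = (A @ R', W') \<and> length (A @ R') \<le> k \<and> (W' \<noteq> {} \<longrightarrow> length (A @ R') = k) \<and>
    ordered_partition (T \<union> set xs) R' W' \<and> card W' \<le> card W + length xs \<and>
    a + potential C R' W' \<le> potential C R W + (24 * k + (k - length C) + 2) * length xs"
  using assms(1-7)
proof (induction xs arbitrary: R W T a)
  case Nil
  then show ?case by (intro exI[of _ R] exI[of _ W]) auto
next
  case (Cons x xs)
  obtain S1 a1 where 1: "assign \<gamma> (length A) x (A @ R, W) = (S1, a1)" by fastforce
  have xT: "x \<notin> T" using Cons.prems by simp
  obtain R1 W1 where R1: "S1 = (A @ R1, W1)" "length (A @ R1) \<le> k" "W1 \<noteq> {} \<longrightarrow> length (A @ R1) = k"
    "ordered_partition (insert x T) R1 W1" "card W1 \<le> Suc (card W)"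
    "a1 + potential C R1 W1 \<le> potential C R W + (24 * k + (k - length C) + 2)"
    using assign_potential[OF 1 Cons.prems(2-5) xT assms(8)] by metis
  obtain a2 where 2: "assign_list \<gamma> (length A) xs (A @ R1, W1) = (S, a2)" "a = a1 + a2"
    using Cons.prems(1) 1 R1 by (auto split: prod.splits)
  have "set xs \<inter> insert x T = {}" "finite (insert x T)" "distinct xs" using Cons.prems by auto
  from Cons.IH[OF 2(1) R1(2-4) this(2,1,3)] obtain R' W' where R': "S = (A @ R', W')" "length (A @ R') \<le> k"
    "W' \<noteq> {} \<longrightarrow> length (A @ R') = k" "ordered_partition (insert x T \<union> set xs) R' W'" "card W' \<le> card W1 + length xs"
    "a2 + potential C R' W' \<le> potential C R1 W1 + (24 * k + (k - length C) + 2) * length xs"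
    by metis
  have "insert x T \<union> set xs = T \<union> set (x # xs)" by simp
  then show ?case using R' R1(5,6) 2(2) by (intro exI[of _ R'] exI[of _ W']) (simp add: Un_insert_left)
qed

section \<open>Promotion, rebuilding and reclustering\<close>

lemma promote_cases:
  assumes "promote \<gamma> (L, W) S b"
  obtains (empty) "W = {}" "S = (L, {})" "b = 1"
  | (new) u where "last_to_expire u W" "S = (L @ [(u, captured \<gamma> u W)], W - captured \<gamma> u W)"
     "u \<in> captured \<gamma> u W" "captured \<gamma> u W \<subseteq> W" "P_set (u, captured \<gamma> u W) = {}" "b = 1 + 2 * card W + card (captured \<gamma> u W)"
  using assms
proof cases
  case (promote_new u)
  then have "u \<in> captured \<gamma> u W" "captured \<gamma> u W \<subseteq> W" "P_set (u, captured \<gamma> u W) = {}"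
    by (auto simp: captured_def last_to_expire_def P_set_def)
  then show ?thesis using that promote_new by auto
qed (use that in auto)

text \<open>The new center is last to expire, so it enters no \<open>earlier\<close> count of the
  remaining unclustered points. Captured points keep their count and lie in its
  \<open>V_set\<close>; the potential is unchanged and only the scans and moves are paid.\<close>

lemma promote_potential:
  assumes "promote \<gamma> (L, W) S b" "ordered_partition Q L W" "finite W"
    and "length L < k" "W \<noteq> {} \<longrightarrow> Suc (length L) = k"
  shows "well_formed Q S \<and> b + pot S \<le> pot (L, W) + (1 + 3 * card W)"
  using assms(1)
proof (cases rule: promote_cases)
  case empty
  then show ?thesis using assms by (auto simp: well_formed_def)
next
  case (new u)
  let ?U = "captured \<gamma> u W" and ?C = "rev (map fst L)"
  have "ordered_partition Q (L @ [(u, ?U)]) (W - ?U)"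
    using assms(2) new by (auto simp: ordered_partition_append)
  moreover have "(\<Sum>x\<in>W - ?U. earlier (u # ?C) x) = (\<Sum>x\<in>W - ?U. earlier ?C x)"
    using new(1) by (intro sum.cong) (auto simp: last_to_expire_def earlier_def)
  moreover have "(\<Sum>x\<in>W. earlier ?C x) = (\<Sum>x\<in>W - ?U. earlier ?C x) + (\<Sum>x\<in>?U. earlier ?C x)"
    using assms(3) new sum.subset_diff by metis
  moreover have "V_set (u, ?U) = ?U" using new by (simp add: V_set_def)
  moreover have "card ?U \<le> card W" using new assms(3) card_mono by auto
  ultimately show ?thesis using new assms potential_append[of "[]" L "[]" W]
    by (auto simp: well_formed_def pot_def potential_append[of "[]" L "[(u, ?U)]"])
qed

text \<open>Each round costs at most \<open>2 + 3 * card W\<close>, and its center is last to expire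
  among the points left, whence the empty \<open>P_set\<close>.\<close>

lemma rebuild_partition:
  assumes "rebuild \<gamma> m (L, W) S c" "finite W"
  shows "\<exists>N W'. S = (L @ N, W') \<and> ordered_partition W N W' \<and> length N \<le> m \<and> (W' \<noteq> {} \<longrightarrow> length N = m) \<and>
    (\<forall>cD \<in> set N. P_set cD = {}) \<and> c \<le> 1 + m * (2 + 3 * card W)"
  using assms
proof (induction m "(L, W)" S c arbitrary: L W rule: rebuild.induct)
  case (rebuild_step W L S a m S' b)
  from rebuild_step(2) show ?case
  proof (cases rule: promote_cases)
    case (new u)
    let ?U = "captured \<gamma> u W"
    have fin: "finite (W - ?U)" using rebuild_step by simp
    from rebuild_step(4)[OF new(2) this] obtain N W' where N: "S' = ((L @ [(u, ?U)]) @ N, W')"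
       "ordered_partition (W - ?U) N W'" "length N \<le> m" "W' \<noteq> {} \<longrightarrow> length N = m"
       "\<forall>cD \<in> set N. P_set cD = {}" "b \<le> 1 + m * (2 + 3 * card (W - ?U))" by metis
    have "card (W - ?U) \<le> card W" "card ?U \<le> card W" using rebuild_step new card_mono by (metis Diff_subset, metis)
    moreover from this have "m * (2 + 3 * card (W - ?U)) \<le> m * (2 + 3 * card W)" by simp
    with N(6) have "b \<le> 1 + m * (2 + 3 * card W)" by linarith
    moreover have "Suc m * (2 + 3 * card W) = (2 + 3 * card W) + m * (2 + 3 * card W)" by simp
    ultimately have "1 + a + b \<le> 1 + Suc m * (2 + 3 * card W)" using new(6) by linarith
    then show ?thesis using N new by (intro exI[of _ "(u, ?U) # N"] exI[of _ W']) auto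
  qed (use rebuild_step in auto)
qed auto

text \<open>Per point of \<open>U'\<close>, collecting it, rebuilding and the new potential take at
  most 1, 3 and 8 times \<open>k\<close>. There are at most two such points per point of a
  \<open>P_set\<close> in \<open>R\<close>, which explains the 24 in \<open>potential\<close>. The
  rest, \<open>4 * k + 2\<close>, does not depend on \<open>U'\<close>.\<close>

lemma recluster_potential:
  assumes "recluster \<gamma> S S' e" "well_formed Q S" "finite Q"
  shows "well_formed Q S' \<and> balanced 0 S' \<and> e + pot S' \<le> pot S + (4 * k + 2)"
  using assms(1)
proof cases
  case (recluster_none L W)
  then show ?thesis using assms by (auto simp: balanced_def unbalanced_iff well_formed_def not_less)
next
  case (recluster_some L W i U' a)
  define A R where "A = take i L" and "R = drop i L"
  have L: "L = A @ R" by (simp add: A_def R_def)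
  have un: "card W + V_total R < P_total R" using recluster_some R_def unbalanced_iff by simp
  then have "i < length L" by (cases "i < length L") (auto simp: R_def)
  then have A: "length A = i" "i < k" "length L \<le> k"
    using assms(2) recluster_some by (auto simp: A_def well_formed_def)
  obtain T where T: "ordered_partition Q A T" "ordered_partition T R W"
    using assms(2) recluster_some(1) L by (auto simp: well_formed_def ordered_partition_append)
  have U': "U' = T" using T ordered_partition_union recluster_some R_def by metis
  then have fin: "finite U'" using T assms(3) ordered_partition_subset finite_subset by metis
  have cardU: "card U' \<le> 2 * P_total R" using ordered_partition_card[OF T(2)] fin U' un by simp
  obtain N W' where N: "S' = (A @ N, W')" "ordered_partition U' N W'" "length N \<le> k - i" "W' \<noteq> {} \<longrightarrow> length N = k - i"
    "\<forall>cD \<in> set N. P_set cD = {}" "a \<le> 1 + (k - i) * (2 + 3 * card U')"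
    using rebuild_partition[OF recluster_some(6) fin] A_def by metis
  let ?C = "rev (map fst A) @ []"
  have "well_formed Q S'" using N A T U' by (auto simp: well_formed_def ordered_partition_append)
  moreover have "balanced 0 S'"
  proof -
    have "P_total (drop i' (A @ N)) \<le> card W' + V_total (drop i' (A @ N))" for i'
    proof -
      have "\<forall>cD \<in> set (drop (i' - i) N). P_set cD = {}" using N in_set_dropD by metis
      then have 0: "P_total (drop (i' - length A) N) = 0" using A by (simp add: sum_list_eq_0_iff)
      \<comment> \<open>By minimality of \<open>i\<close> the old suffix from \<open>i'\<close> was
        balanced; subtracting the unbalanced part \<open>R\<close> and \<open>W\<close> leaves the
        inequality for \<open>A\<close> alone.\<close>
      have "P_total (drop i' A) \<le> V_total (drop i' A)"
      proof (cases "i' < i")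
        case True
        then have "\<not> unbalanced (L, W) i'" using recluster_some by simp
        then show ?thesis
          using un True A unfolding unbalanced_iff L by simp
      qed (use A in simp)
      then show ?thesis unfolding drop_append map_append sum_list_append using 0 by linarith
    qed
    then show ?thesis using N by (simp add: balanced_def)
  qed
  moreover have "e + pot S' \<le> pot S + (4 * k + 2)"
  proof -
    have "potential ?C N W' \<le> 8 * k * (V_total N + card W')"
      using N A by (intro potential_no_P) auto
    also have "\<dots> \<le> 8 * k * card U'" using ordered_partition_card[OF N(2) fin] by simp
    finally have new: "potential ?C N W' \<le> 8 * k * card U'" .
    have old: "24 * k * P_total R \<le> potential ?C R W" by (rule potential_ge)
    have "card U' \<le> k * card U'" using k_pos by simp
    moreover have "(k - i) * (2 + 3 * card U') \<le> k * (2 + 3 * card U')" by (intro mult_le_mono1) simp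
    then have "a \<le> 1 + k * (2 + 3 * card U')" using N(6) by linarith
    then have "a \<le> 1 + 2 * k + 3 * (k * card U')" by (simp add: algebra_simps)
    moreover have "12 * (k * card U') \<le> 24 * (k * P_total R)" using cardU by simp
    moreover have "e \<le> 2 * k + 1 + card U' + a" using recluster_some(2) A by simp
    moreover have "pot S = potential [] A {} + potential ?C R W" "pot S' = potential [] A {} + potential ?C N W'"
      unfolding recluster_some(1) N(1) L by (simp_all add: pot_def potential_append[of "[]" A])
    ultimately show ?thesis using new old by linarith
  qed
  ultimately show ?thesis by simp
qed

section \<open>Insertion and deletion for one radius\<close>

text \<open>With no center in front, the assignment is charged \<open>25 * k + 2\<close>;
  reclustering adds \<open>4 * k + 2\<close>, bookkeeping 1.\<close>

lemma insert_point_potential: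
  assumes "insert_point \<gamma> p S S' c" "well_formed Q S" "finite Q" "p \<notin> Q"
  shows "well_formed (insert p Q) S' \<and> balanced 0 S' \<and> c + pot S' \<le> pot S + (29 * k + 5)"
  using assms(1)
proof cases
  case (insert_pointI S1 a b)
  obtain L W where S: "S = (L, W)" by fastforce
  have L: "assign \<gamma> (length ([] :: ('a \<times> 'a set) list)) p ([] @ L, W) = (S1, a)" "length ([] @ L) \<le> k"
    "W \<noteq> {} \<longrightarrow> length ([] @ L) = k" "ordered_partition Q L W"
    using insert_pointI S assms(2) by (auto simp: well_formed_def)
  have "length ([] :: 'a list) \<le> length ([] :: ('a \<times> 'a set) list)" by simp
  from assign_potential[OF L assms(3,4) this] obtain R' W' where
    1: "S1 = ([] @ R', W')" "length ([] @ R') \<le> k" "W' \<noteq> {} \<longrightarrow> length ([] @ R') = k"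
      "ordered_partition (insert p Q) R' W'"
      "a + potential [] R' W' \<le> potential [] L W + (24 * k + (k - length ([] :: 'a list)) + 2)"
    by metis
  then have R': "S1 = (R', W')" "well_formed (insert p Q) S1"
    "a + potential [] R' W' \<le> potential [] L W + (25 * k + 2)"
    by (auto simp: well_formed_def)
  from recluster_potential[OF insert_pointI(3) R'(2)] show ?thesis
    using R' S insert_pointI assms by (auto simp: pot_def)
qed

text \<open>
  A deletion without reclustering may disturb the balance by one; the summand \<open>5 * r\<close> keeps
  account of this.
\<close>

lemma delete_noncenter_potential:
  assumes "well_formed Q (L, W)" "finite Q" "p \<notin> fst ` set L" "balanced r (L, W)"
  shows "well_formed (Q - {p}) (remove_point p (L, W))" "pot (remove_point p (L, W)) \<le> pot (L, W)"
    "balanced (Suc r) (remove_point p (L, W))"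
proof -
  have part: "ordered_partition Q L W" using assms by (simp add: well_formed_def)
  show "well_formed (Q - {p}) (remove_point p (L, W))"
    using assms ordered_partition_remove[OF part assms(3)] by (auto simp: well_formed_def remove_point_def)
  show "pot (remove_point p (L, W)) \<le> pot (L, W)"
    using potential_remove[OF part assms(2)] by (simp add: pot_def remove_point_def)
  let ?f = "\<lambda>(c, D). (c, D - {p})"
  \<comment> \<open>At most one of the disjoint sets contains \<open>p\<close>. The balance worsens,
    by one, only if this is a \<open>V_set\<close> or the unclustered set.\<close>
  have bal: "P_total (map ?f R) + card W + V_total R \<le> P_total R + card (W - {p}) + V_total (map ?f R) + 1"
    if "ordered_partition T R W" "finite T" for T R
    using that
  proof (induction T R W rule: ordered_partition.induct)
    case (1 T W)
    then show ?case using card_Diff1_le[of W p] by (auto simp: card_Diff_singleton_if)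
  next
    case (2 T c D R W)
    then have fin: "finite D" "D \<subseteq> T" using finite_subset by auto
    show ?case
    proof (cases "p \<in> V_set (c, D)")
      case True
      then have p: "p \<in> D" by (auto simp: V_set_def)
      have "?f cD = cD" if "cD \<in> set R" for cD
      proof -
        obtain c' D' where "cD = (c', D')" by fastforce
        then show ?thesis using ordered_partition_center[of "T - D" R W c' D'] 2 that p by auto
      qed
      then have "map ?f R = R" by (simp add: map_idI)
      moreover have "W - {p} = W" using 2 p ordered_partition_subset[of "T - D" R W] by auto
      moreover have "P_set (c, D) - {p} = P_set (c, D)" using True by (auto simp: V_set_def)
      moreover have "card (V_set (c, D)) = Suc (card (V_set (c, D) - {p}))"
        using True fin by (metis card_Suc_Diff1 finite_V_set snd_conv)
      ultimately show ?thesis by (simp add: P_set_remove V_set_remove)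
    next
      case False
      then have "card (P_set (c, D) - {p}) \<le> card (P_set (c, D))" "V_set (c, D) - {p} = V_set (c, D)"
        using fin by (auto intro!: card_mono)
      then show ?thesis using 2 by (auto simp: P_set_remove V_set_remove)
    qed
  qed
  have "P_total (drop i (map ?f L)) \<le> card (W - {p}) + V_total (drop i (map ?f L)) + Suc r" for i
  proof -
    obtain T where T: "ordered_partition Q (take i L) T" "ordered_partition T (drop i L) W"
      using part ordered_partition_append[of Q "take i L" "drop i L" W] by auto
    then have "finite T" using assms(2) ordered_partition_subset finite_subset by metis
    from bal[OF T(2) this] show ?thesis using assms(4) unfolding drop_map balanced_def
      by (auto dest!: spec[of _ i])
  qed
  then show "balanced (Suc r) (remove_point p (L, W))" by (simp add: balanced_def remove_point_def)
qed

text \<open>If \<open>p\<close> is a center, each other point of its cluster costs 5 beyond its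
  credit, 2 for the assignment and 3 for the scans of \<open>promote\<close>; a point of a later
  \<open>P_set\<close> costs 1. By balance, up to the slack and \<open>p\<close> itself, 5 per
  unclustered point or point of a later \<open>V_set\<close> suffices. The scans of the unclustered
  points add 3, which makes the 8 in \<open>potential\<close>.\<close>

lemma delete_point_potential:
  assumes "delete_point \<gamma> p S S' c" "well_formed Q S" "balanced r S" "Q \<subseteq> X" "first_to_expire p Q"
  shows "\<exists>r'. well_formed (Q - {p}) S' \<and> balanced r' S' \<and> c + pot S' + 5 * r' \<le> pot S + 5 * r + (5 * k + 9)"
proof -
  have fin: "finite Q" using assms(4) finite_X finite_subset by auto
  show ?thesis using assms(1)
  proof cases
    case (delete_noncenter L W)
    with delete_noncenter_potential[of Q L W p r] assms fin show ?thesis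
      by (intro exI[of _ "Suc r"]) auto
  next
    case (delete_noncenter_recluster L W a)
    note * = delete_noncenter_potential[of Q L W p r]
    have "well_formed (Q - {p}) (remove_point p (L, W))" "pot (remove_point p (L, W)) \<le> pot (L, W)"
      using * delete_noncenter_recluster assms fin by auto
    with recluster_potential[OF delete_noncenter_recluster(4) this(1)] fin delete_noncenter_recluster
    show ?thesis by (intro exI[of _ 0]) auto
  next
    case (delete_center i L D xs W L' W' a S1 b e)
    define A R where "A = take i L" and "R = drop (Suc i) L"
    have L: "L = A @ (p, D) # R" and A: "length A = i"
      using id_take_nth_drop[OF delete_center(3)] delete_center(3,4) by (simp_all add: A_def R_def)
    have part: "ordered_partition Q (A @ (p, D) # R) W" and len: "length L \<le> k" "W \<noteq> {} \<longrightarrow> length L = k"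
      using assms(2) delete_center(1) L by (auto simp: well_formed_def)
    have D: "p \<in> D" "D \<subseteq> Q" using ordered_partition_center[OF part, of p D] by auto
    then have finD: "finite D" using fin finite_subset by auto
    obtain T where T: "ordered_partition (Q - D) A T" "ordered_partition T R W"
      using part by (rule ordered_partition_remove_cluster)
    have TQ: "T \<subseteq> Q - D" using T ordered_partition_subset by metis
    then have finT: "finite T" using fin finite_subset by auto
    \<comment> \<open>So \<open>D - {p}\<close> is the \<open>P_set\<close> of the expiring center,
      and \<open>p\<close> counts in \<open>earlier\<close> for every point behind it.\<close>
    have first: "expires_before p x" if "x \<in> Q" "x \<noteq> p" for x
      using that assms(4,5) expires_before_total[of p x] by (auto simp: first_to_expire_def)
    let ?C = "rev (map fst A) @ []"
    \<comment> \<open>During the reassignment \<open>p\<close> is still listed, hence in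
      \<open>?A\<close>; \<open>?C\<close> omits it, so that the potential is already that of the
      list without \<open>p\<close>.\<close>
    let ?A = "A @ [(p, D)]"
    have xs: "set xs \<inter> T = {}" using delete_center(6) TQ by auto
    have "\<exists>R' W''. (L', W') = (?A @ R', W'') \<and> length (?A @ R') \<le> k \<and> (W'' \<noteq> {} \<longrightarrow> length (?A @ R') = k) \<and>
      ordered_partition (T \<union> set xs) R' W'' \<and> card W'' \<le> card W + length xs \<and>
      a + potential ?C R' W'' \<le> potential ?C R W + (24 * k + (k - length ?C) + 2) * length xs"
      using delete_center(7) A len L T finT xs delete_center(5) by (intro assign_list_potential) auto
    then obtain R' where "L' = ?A @ R'" "length (?A @ R') \<le> k" "W' \<noteq> {} \<longrightarrow> length (?A @ R') = k"
      "ordered_partition (T \<union> set xs) R' W'" "card W' \<le> card W + length xs"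
      "a + potential ?C R' W' \<le> potential ?C R W + (24 * k + (k - length ?C) + 2) * length xs"
      by (metis Pair_inject)
    then have R': "L' = A @ (p, D) # R'" "length A + Suc (length R') \<le> k" "W' \<noteq> {} \<longrightarrow> length A + Suc (length R') = k"
      "ordered_partition (T \<union> set xs) R' W'" "card W' \<le> card W + length xs"
      "a + potential ?C R' W' \<le> potential ?C R W + (24 * k + (k - length ?C) + 2) * length xs"
      by simp_all
    have "ordered_partition (Q - D \<union> set xs) A (T \<union> set xs)"
      using T(1) delete_center(6) by (intro ordered_partition_enlarge) auto
    moreover have "Q - D \<union> set xs = Q - {p}" using delete_center(6) D by auto
    ultimately have part': "ordered_partition (Q - {p}) (A @ R') W'"
      using R'(4) by (auto simp: ordered_partition_append)
    then have finW': "finite W'" using fin ordered_partition_subset finite_subset by (metis finite_Diff)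
    have prom: "promote \<gamma> (A @ R', W') S1 b" using delete_center(8) R'(1) A by simp
    have S1: "well_formed (Q - {p}) S1" "b + pot S1 \<le> pot (A @ R', W') + (1 + 3 * card W')"
      using promote_potential[OF prom part' finW'] R'(2,3) by auto
    have S': "well_formed (Q - {p}) S'" "balanced 0 S'" "e + pot S' \<le> pot S1 + (4 * k + 2)"
      using recluster_potential[OF delete_center(9) S1(1)] fin by auto
    have PV: "P_set (p, D) = D - {p}" "V_set (p, D) = {p}"
      using first D by (auto simp: P_set_def V_set_def)
    have s: "length xs = card (P_set (p, D))" unfolding PV
      using delete_center(5,6) distinct_card by metis
    have shift: "potential ?C R W + 8 * (V_total R + card W) \<le> potential (p # ?C) R W + P_total R"
      using TQ D first by (intro potential_shift[OF _ _ T(2) finT]) (auto simp: earlier_def)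
    have "pot S = potential [] A {} + ((24 * k + (k - length ?C)) * length xs
       + 8 * (\<Sum>x\<in>V_set (p, D). earlier ?C x) + potential (p # ?C) R W)"
      unfolding delete_center(1) L s by (simp add: pot_def potential_append[of "[]" A])
    then have old: "pot S \<ge> potential [] A {} + (24 * k + (k - length ?C)) * length xs + potential (p # ?C) R W"
      by simp
    have new: "pot (A @ R', W') = potential [] A {} + potential ?C R' W'"
      by (simp add: pot_def potential_append[of "[]" A])
    \<comment> \<open>Balance at the position of \<open>p\<close>; the summand 1 is
      \<open>p\<close>, the only point of \<open>V_set (p, D)\<close>.\<close>
    have bal: "length xs + P_total R \<le> card W + 1 + V_total R + r"
      using assms(3) A unfolding delete_center(1) L s by (auto simp: balanced_def PV dest!: spec[of _ i])
    have "a + pot (A @ R', W') + 8 * (V_total R + card W) \<le> pot S + P_total R + 2 * length xs"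
      using R'(6) shift old new by (simp add: algebra_simps)
    then have "c + pot S' \<le> pot S + 5 * r + (5 * k + 9)"
      using bal S'(3) S1(2) R'(1,2,5) delete_center(2) by simp
    with S' show ?thesis by (intro exI[of _ 0]) simp
  qed
qed


section \<open>The queue and all radii together\<close>

text \<open>Every point in the queue has paid for its extraction and deletion.\<close>

definition global_pot :: "nat \<Rightarrow> 'a set \<Rightarrow> (real \<Rightarrow> 'a clustering) \<Rightarrow> (real \<Rightarrow> nat) \<Rightarrow> nat" where
  "global_pot H Q S r = (\<Sum>\<gamma>\<in>\<Gamma>. pot (S \<gamma>) + 5 * r \<gamma>) + card Q * (1 + H + card \<Gamma> * (5 * k + 10))"

definition maintained :: "'a set \<Rightarrow> (real \<Rightarrow> 'a clustering) \<Rightarrow> (real \<Rightarrow> nat) \<Rightarrow> bool" where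
  "maintained Q S r \<longleftrightarrow> (\<forall>\<gamma>\<in>\<Gamma>. well_formed Q (S \<gamma>) \<and> balanced (r \<gamma>) (S \<gamma>))"

text \<open>In use, \<open>T\<close> is the time of the previous call. The queue may hold expired
  points during the flush, but it stays inside that earlier active set, so \<open>H\<close> covers
  each extraction. The final 1 is the inspection that ends the loop.\<close>

lemma flush_potential:
  assumes "flush t (Q, S) (Q', S') c" "Q \<subseteq> active T" "maintained Q S r"
    and H: "\<forall>T Q. Q \<subseteq> active T \<longrightarrow> Q \<noteq> {} \<longrightarrow> heap_cost (card Q) \<le> H"
  shows "\<exists>r'. Q' \<subseteq> Q \<and> (\<forall>q\<in>Q'. t < t_del q) \<and> maintained Q' S' r' \<and>
    c + global_pot H Q' S' r' \<le> global_pot H Q S r + 1"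
  using assms(1-3)
proof (induction "(Q, S)" "(Q', S')" c arbitrary: Q S r rule: flush.induct)
  case flush_done
  then show ?case by (intro exI[of _ r]) auto
next
  case (flush_step q Q S S1 a b)
  have X: "Q \<subseteq> X" using flush_step(6) by (auto simp: active_def)
  have fin: "finite Q" using flush_step(6) finite_active finite_subset by blast
  have q: "q \<in> Q" using flush_step(1) by (simp add: first_to_expire_def)
  have "\<forall>\<gamma>\<in>\<Gamma>. \<exists>r'. well_formed (Q - {q}) (S1 \<gamma>) \<and> balanced r' (S1 \<gamma>) \<and>
      a \<gamma> + pot (S1 \<gamma>) + 5 * r' \<le> pot (S \<gamma>) + 5 * r \<gamma> + (5 * k + 9)"
    using delete_point_potential flush_step X unfolding maintained_def by blast
  then obtain r1 where r1: "\<forall>\<gamma>\<in>\<Gamma>. well_formed (Q - {q}) (S1 \<gamma>) \<and> balanced (r1 \<gamma>) (S1 \<gamma>) \<and>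
      a \<gamma> + pot (S1 \<gamma>) + 5 * r1 \<gamma> \<le> pot (S \<gamma>) + 5 * r \<gamma> + (5 * k + 9)"
    by metis
  then have "maintained (Q - {q}) S1 r1" by (simp add: maintained_def)
  moreover have "Q - {q} \<subseteq> active T" using flush_step(6) by auto
  ultimately obtain r' where r': "Q' \<subseteq> Q - {q}" "\<forall>q\<in>Q'. t < t_del q" "maintained Q' S' r'"
     "b + global_pot H Q' S' r' \<le> global_pot H (Q - {q}) S1 r1 + 1"
    using flush_step(5) by metis
  have "(\<Sum>\<gamma>\<in>\<Gamma>. (1 + a \<gamma>) + (pot (S1 \<gamma>) + 5 * r1 \<gamma>)) \<le> (\<Sum>\<gamma>\<in>\<Gamma>. (pot (S \<gamma>) + 5 * r \<gamma>) + (5 * k + 10))"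
    using r1 by (intro sum_mono) auto
  then have "(\<Sum>\<gamma>\<in>\<Gamma>. 1 + a \<gamma>) + (\<Sum>\<gamma>\<in>\<Gamma>. pot (S1 \<gamma>) + 5 * r1 \<gamma>)
      \<le> (\<Sum>\<gamma>\<in>\<Gamma>. pot (S \<gamma>) + 5 * r \<gamma>) + card \<Gamma> * (5 * k + 10)"
    unfolding sum.distrib[of "\<lambda>\<gamma>. 1 + a \<gamma>"] sum.distrib[of "\<lambda>\<gamma>. pot (S \<gamma>) + 5 * r \<gamma>"] by simp
  moreover have "heap_cost (card Q) \<le> H" using H flush_step(6) q by blast
  moreover have "card Q = Suc (card (Q - {q}))" by (rule card_Suc_Diff1[OF fin q, symmetric])
  ultimately have "(1 + heap_cost (card Q) + (\<Sum>\<gamma>\<in>\<Gamma>. 1 + a \<gamma>)) + global_pot H (Q - {q}) S1 r1 \<le> global_pot H Q S r"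
    by (simp add: global_pot_def)
  with r' show ?case by (intro exI[of _ r']) auto
qed

text \<open>An arriving point pays for its own queue insertion and for its later extraction, hence
  \<open>2 * H\<close>. Per radius it pays \<open>(29 * k + 6) + (5 * k + 10)\<close>, at most
  \<open>50 * k\<close> because \<open>k\<close> is positive.\<close>

lemma update_potential:
  assumes "update p t (Q, S) (Q', S') c" "Q \<subseteq> active T" "T \<le> t" "maintained Q S r"
    and p: "\<forall>x. p = Some x \<longrightarrow> x \<in> X \<and> t = t_arr x \<and> x \<notin> Q"
    and H: "\<forall>T Q. Q \<subseteq> active T \<longrightarrow> Q \<noteq> {} \<longrightarrow> heap_cost (card Q) \<le> H"
  shows "\<exists>r'. Q' \<subseteq> Q \<union> set_option p \<and> Q' \<subseteq> active t \<and> maintained Q' S' r' \<and>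
    c + global_pot H Q' S' r' \<le> global_pot H Q S r + (3 + 2 * H + 50 * card \<Gamma> * k)"
  using assms(1)
proof cases
  case (update_null a)
  from flush_potential[OF this(3) assms(2,4) H] show ?thesis
    using update_null assms(2,3) by (fastforce simp: active_def)
next
  case (update_point Q1 S1 a x b)
  from flush_potential[OF update_point(4) assms(2,4) H] obtain r1 where
    r1: "Q1 \<subseteq> Q" "\<forall>q\<in>Q1. t < t_del q" "maintained Q1 S1 r1"
      "a + global_pot H Q1 S1 r1 \<le> global_pot H Q S r + 1" by metis
  have x: "x \<in> X" "t = t_arr x" "x \<notin> Q1" using p update_point r1 by auto
  have act: "insert x Q1 \<subseteq> active t"
    using x r1 assms(2,3) arr_less_del by (fastforce simp: active_def)
  then have fin: "finite Q1" using finite_subset[OF _ finite_active] by blast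
  have ins: "\<forall>\<gamma>\<in>\<Gamma>. well_formed (insert x Q1) (S' \<gamma>) \<and> balanced 0 (S' \<gamma>) \<and>
      b \<gamma> + pot (S' \<gamma>) \<le> pot (S1 \<gamma>) + (29 * k + 5)"
  proof
    fix \<gamma> assume "\<gamma> \<in> \<Gamma>"
    moreover from this have "well_formed Q1 (S1 \<gamma>)" using r1(3) by (simp add: maintained_def)
    ultimately show "well_formed (insert x Q1) (S' \<gamma>) \<and> balanced 0 (S' \<gamma>) \<and>
      b \<gamma> + pot (S' \<gamma>) \<le> pot (S1 \<gamma>) + (29 * k + 5)"
      using insert_point_potential[OF _ _ fin x(3)] update_point(5) by blast
  qed
  then have "maintained Q' S' (\<lambda>_. 0)" using update_point by (simp add: maintained_def)
  moreover have "(\<Sum>\<gamma>\<in>\<Gamma>. (1 + b \<gamma>) + pot (S' \<gamma>)) \<le> (\<Sum>\<gamma>\<in>\<Gamma>. (pot (S1 \<gamma>) + 5 * r1 \<gamma>) + (29 * k + 6))"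
    using ins by (intro sum_mono) auto
  then have "(\<Sum>\<gamma>\<in>\<Gamma>. 1 + b \<gamma>) + (\<Sum>\<gamma>\<in>\<Gamma>. pot (S' \<gamma>))
      \<le> (\<Sum>\<gamma>\<in>\<Gamma>. pot (S1 \<gamma>) + 5 * r1 \<gamma>) + card \<Gamma> * (29 * k + 6)"
    unfolding sum.distrib[of "\<lambda>\<gamma>. 1 + b \<gamma>"] sum.distrib[of "\<lambda>\<gamma>. pot (S1 \<gamma>) + 5 * r1 \<gamma>"] by simp
  moreover have "heap_cost (card (insert x Q1)) \<le> H" using H act by blast
  moreover have "card \<Gamma> * (29 * k + 6) + card \<Gamma> * (5 * k + 10) \<le> 50 * card \<Gamma> * k"
  proof -
    have "card \<Gamma> * ((29 * k + 6) + (5 * k + 10)) \<le> card \<Gamma> * (50 * k)"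
      using k_pos by (intro mult_le_mono2) simp
    then show ?thesis by (simp add: algebra_simps)
  qed
  ultimately have "c + global_pot H Q' S' (\<lambda>_. 0) \<le> global_pot H Q S r + (3 + 2 * H + 50 * card \<Gamma> * k)"
    using r1(4) update_point fin x by (simp add: global_pot_def)
  then show ?thesis using \<open>maintained Q' S' (\<lambda>_. 0)\<close> act r1 update_point
    by (intro exI[of _ "\<lambda>_. 0"]) auto
qed

lemma updates_potential:
  assumes "updates calls s s' c" "s = (Q, S)" "Q \<subseteq> active T" "maintained Q S r"
    and "sorted (T # map snd calls)"
    and "\<forall>(p, t) \<in> set calls. \<forall>x. p = Some x \<longrightarrow> x \<in> X \<and> t = t_arr x \<and> x \<notin> Q"
    and "\<forall>i j. i < j \<longrightarrow> j < length calls \<longrightarrow> fst (calls ! i) \<noteq> None \<longrightarrow> fst (calls ! i) \<noteq> fst (calls ! j)"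
    and H: "\<forall>T Q. Q \<subseteq> active T \<longrightarrow> Q \<noteq> {} \<longrightarrow> heap_cost (card Q) \<le> H"
  shows "c \<le> global_pot H Q S r + length calls * (3 + 2 * H + 50 * card \<Gamma> * k)"
  using assms(1-7)
proof (induction calls s s' c arbitrary: Q S T r rule: updates.induct)
  case (updates_Cons p t s s1 a calls s2 b)
  obtain Q1 S1 where s1: "s1 = (Q1, S1)" by fastforce
  have p: "\<forall>x. p = Some x \<longrightarrow> x \<in> X \<and> t = t_arr x \<and> x \<notin> Q"
    using updates_Cons.prems(5) by auto
  have "update p t (Q, S) (Q1, S1) a" "T \<le> t" using updates_Cons s1 by auto
  from update_potential[OF this(1) updates_Cons.prems(2) this(2) updates_Cons.prems(3) p H]
  obtain r1 where r1: "Q1 \<subseteq> Q \<union> set_option p" "Q1 \<subseteq> active t" "maintained Q1 S1 r1"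
    "a + global_pot H Q1 S1 r1 \<le> global_pot H Q S r + (3 + 2 * H + 50 * card \<Gamma> * k)" by metis
  \<comment> \<open>No point arrives twice, so the points of later calls also stay outside the
    enlarged queue.\<close>
  have fresh: "q \<noteq> Some x" if q: "(q, t') \<in> set calls" and x: "x \<in> set_option p" for q t' x
  proof -
    obtain j where "j < length calls" "calls ! j = (q, t')" using q by (auto simp: in_set_conv_nth)
    then show ?thesis using updates_Cons.prems(6)[rule_format, of 0 "Suc j"] x by auto
  qed
  have "b \<le> global_pot H Q1 S1 r1 + length calls * (3 + 2 * H + 50 * card \<Gamma> * k)"
  proof (rule updates_Cons.IH[OF s1 r1(2,3)])
    show "sorted (t # map snd calls)" using updates_Cons.prems(4) by simp
    show "\<forall>(q, t') \<in> set calls. \<forall>x. q = Some x \<longrightarrow> x \<in> X \<and> t' = t_arr x \<and> x \<notin> Q1"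
      using updates_Cons.prems(5) r1(1) fresh by fastforce
    show "\<forall>i j. i < j \<longrightarrow> j < length calls \<longrightarrow> fst (calls ! i) \<noteq> None \<longrightarrow> fst (calls ! i) \<noteq> fst (calls ! j)"
    proof (intro allI impI)
      fix i j assume "i < j" "j < length calls" "fst (calls ! i) \<noteq> None"
      then show "fst (calls ! i) \<noteq> fst (calls ! j)"
        using updates_Cons.prems(6)[rule_format, of "Suc i" "Suc j"] by simp
    qed
  qed
  with r1(4) show ?case by simp
qed simp

text \<open>The potential starts at zero and is a natural number, so the amortized charges alone
  bound the cost. The empty initial queue allows \<open>T = 0\<close>, which precedes every
  call.\<close>

lemma operations_le:
  assumes "call_sequence calls" "updates calls initial_state s c"
    and "\<forall>T Q. Q \<subseteq> active T \<longrightarrow> Q \<noteq> {} \<longrightarrow> heap_cost (card Q) \<le> H"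
  shows "c \<le> length calls * (3 + 2 * H + 50 * card \<Gamma> * k)"
proof -
  have "maintained {} (\<lambda>_. ([], {})) (\<lambda>_. 0)"
    by (simp add: maintained_def well_formed_def balanced_def)
  then have "c \<le> global_pot H {} (\<lambda>_. ([], {})) (\<lambda>_. 0) + length calls * (3 + 2 * H + 50 * card \<Gamma> * k)"
    using assms by (intro updates_potential[where T = 0]) (auto simp: call_sequence_def initial_state_def)
  then show ?thesis by (simp add: global_pot_def pot_def)
qed

section \<open>The number of radii\<close>

lemma d_min_pos: "d_min > 0" and d_max_pos: "d_max > 0"
proof -
  let ?D = "{d x y | x y. x \<in> X \<and> y \<in> X \<and> x \<noteq> y}"
  have "?D = (\<lambda>(x, y). d x y) ` {(x, y) \<in> X \<times> X. x \<noteq> y}" by auto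
  moreover have "finite {(x, y) \<in> X \<times> X. x \<noteq> y}"
    using finite_X by (auto intro: finite_subset[of _ "X \<times> X"])
  ultimately have fin: "finite ?D" by simp
  have ne: "?D \<noteq> {}" using two_points by blast
  have D: "d_min \<in> ?D" "d_max \<in> ?D"
    unfolding d_min_def d_max_def using Min_in[OF fin ne] Max_in[OF fin ne] by auto
  have pos: "z > 0" if "z \<in> ?D" for z
    using that X_subset by (auto intro!: mdist_pos_less)
  show "d_min > 0" "d_max > 0" by (rule pos[OF D(1)], rule pos[OF D(2)])
qed

text \<open>From \<open>ln (1 + \<beta>) >= \<beta> / (1 + \<beta>)\<close> the change of base costs
  a factor of at most \<open>(1 + \<beta>) / \<beta> = (2 + \<epsilon>) / \<epsilon>\<close>. The 3
  comes from the two roundings and from counting both ends.\<close>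

lemma card_\<Gamma>_le:
  assumes "aspect_ratio > 1" "\<epsilon> \<le> \<epsilon>\<^sub>0"
  shows "real (card \<Gamma>) \<le> (2 + \<epsilon>\<^sub>0) * (log 2 aspect_ratio / \<epsilon>) + 3"
proof -
  let ?lo = "\<lfloor>log (1 + \<beta>) d_min\<rfloor>" and ?hi = "\<lceil>log (1 + \<beta>) d_max\<rceil>"
  have \<beta>: "\<beta> > 0" "\<beta> = \<epsilon> / 2" using eps_pos by (auto simp: \<beta>_def)
  have "\<Gamma> = (\<lambda>i. (1 + \<beta>) powi i) ` {?lo..?hi}" by (auto simp: \<Gamma>_def)
  then have "card \<Gamma> \<le> nat (?hi - ?lo + 1)" using card_image_le[of "{?lo..?hi}"] by simp
  moreover have "log (1 + \<beta>) aspect_ratio = log (1 + \<beta>) d_max - log (1 + \<beta>) d_min"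
    using d_min_pos d_max_pos unfolding aspect_ratio_def by (simp add: log_divide)
  moreover have "real_of_int ?hi < log (1 + \<beta>) d_max + 1" "real_of_int ?lo > log (1 + \<beta>) d_min - 1"
    by linarith+
  moreover have pos: "log (1 + \<beta>) aspect_ratio > 0" using assms \<beta> by simp
  ultimately have 1: "real (card \<Gamma>) \<le> log (1 + \<beta>) aspect_ratio + 3" by linarith
  have "\<beta> / (1 + \<beta>) \<le> ln (1 + \<beta>)"
    using ln_add1_ge[of \<beta>] \<beta>(1) by (simp add: add.commute)
  then have "inverse (ln (1 + \<beta>)) \<le> inverse (\<beta> / (1 + \<beta>))"
    using \<beta>(1) by (intro le_imp_inverse_le) auto
  then have 2: "1 / ln (1 + \<beta>) \<le> (1 + \<beta>) / \<beta>"
    by (simp add: inverse_eq_divide)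
  have ln: "ln aspect_ratio > 0" using assms by simp
  have "log (1 + \<beta>) aspect_ratio = ln aspect_ratio * (1 / ln (1 + \<beta>))" by (simp add: log_def)
  also have "\<dots> \<le> ln aspect_ratio * ((1 + \<beta>) / \<beta>)" using 2 ln by (intro mult_left_mono) auto
  also have "\<dots> = (2 + \<epsilon>) * (ln aspect_ratio / \<epsilon>)" using \<beta> eps_pos by (simp add: field_simps)
  also have "\<dots> \<le> (2 + \<epsilon>\<^sub>0) * (log 2 aspect_ratio / \<epsilon>)"
  proof (intro mult_mono divide_right_mono)
    have "ln (2::real) \<le> 1" using ln_2_less_1 by simp
    then show "ln aspect_ratio \<le> log 2 aspect_ratio"
      using ln by (simp add: log_def field_simps)
  qed (use assms eps_pos ln in auto)
  finally show ?thesis using 1 by simp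
qed

end

section \<open>The asymptotic bound\<close>

text \<open>The bounds \<open>\<epsilon>\<^sub>0\<close> and \<open>\<Delta>\<^sub>0\<close> keep
  \<open>log 2 aspect_ratio / \<epsilon>\<close> above a positive constant, so that additive
  constants can be absorbed. \<open>K\<close> depends only on them and on \<open>heap_cost\<close>,
  being chosen before the metric space and the calls.\<close>

theorem theorem3p9:
  fixes heap_cost :: "nat \<Rightarrow> nat" and \<epsilon>\<^sub>0 \<Delta>\<^sub>0 :: real
  assumes "(\<lambda>m. real (heap_cost m)) \<in> O(\<lambda>m. log 2 (real m))"
    and "\<epsilon>\<^sub>0 > 0" and "\<Delta>\<^sub>0 > 1"
  shows "\<exists>K > 0. \<forall>(M :: 'a set) d X k t_arr t_del \<epsilon> n calls s c.
    lifetime_clustering M d X k t_arr t_del \<epsilon> \<longrightarrow>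
    \<epsilon> \<le> \<epsilon>\<^sub>0 \<longrightarrow> \<Delta>\<^sub>0 \<le> lifetime_clustering.aspect_ratio d X \<longrightarrow>
    lifetime_clustering.call_sequence X t_arr calls \<longrightarrow> length calls = n \<longrightarrow>
    lifetime_clustering.updates d X k t_arr t_del \<epsilon> heap_cost calls
      lifetime_clustering.initial_state s c \<longrightarrow>
    real c \<le> K * (real n *
      (Max (range (\<lambda>t. log 2 (real (card (lifetime_clustering.active X t_arr t_del t)))))
        + log 2 (lifetime_clustering.aspect_ratio d X) / \<epsilon> * real k))"
proof -
  obtain h0 where h0: "h0 > 0" "eventually (\<lambda>m. norm (real (heap_cost m)) \<le> h0 * norm (log 2 (real m))) at_top"
    using assms(1) by (elim landau_o.bigE) auto
  then obtain m0 where m0: "\<And>m. m \<ge> m0 \<Longrightarrow> real (heap_cost m) \<le> h0 * \<bar>log 2 (real m)\<bar>"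
    by (auto simp: eventually_at_top_linorder)
  \<comment> \<open>Covers the finitely many heap sizes to which the asymptotic bound does not
    apply.\<close>
  define h1 where "h1 = (\<Sum>m<m0. heap_cost m)"
  have heap: "real (heap_cost m) \<le> h0 * log 2 (real m) + real h1" if "m \<ge> 1" for m
  proof (cases "m \<ge> m0")
    case True
    then show ?thesis using m0[of m] that by simp
  next
    case False
    then have "heap_cost m \<le> h1" unfolding h1_def by (intro member_le_sum) auto
    moreover have "0 \<le> h0 * log 2 (real m)" using h0 that by simp
    ultimately show ?thesis by linarith
  qed
  define y0 where "y0 = log 2 \<Delta>\<^sub>0 / \<epsilon>\<^sub>0"
  have y0: "y0 > 0" using assms by (simp add: y0_def)
  \<comment> \<open>\<open>2 * h0\<close> serves the logarithm of the active set size. The rest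
    serves the term with \<open>k\<close>: the number of radii, and the additive constants divided
    by \<open>y0\<close>.\<close>
  define K where "K = 2 * h0 + (50 * (2 + \<epsilon>\<^sub>0 + 3 / y0) + (3 + 2 * real h1) / y0)"
  have K: "K \<ge> 2 * h0" "K \<ge> 50 * (2 + \<epsilon>\<^sub>0 + 3 / y0) + (3 + 2 * real h1) / y0"
    using h0 assms y0 by (auto simp: K_def)
  have "K > 0" using K h0 by linarith
  moreover have "real c \<le> K * (real n *
      (Max (range (\<lambda>t. log 2 (real (card (lifetime_clustering.active X t_arr t_del t)))))
        + log 2 (lifetime_clustering.aspect_ratio d X) / \<epsilon> * real k))"
    if lc: "lifetime_clustering M d X k t_arr t_del \<epsilon>" and eps: "\<epsilon> \<le> \<epsilon>\<^sub>0"
      and asp: "\<Delta>\<^sub>0 \<le> lifetime_clustering.aspect_ratio d X"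
      and calls: "lifetime_clustering.call_sequence X t_arr calls" "length calls = n"
        "lifetime_clustering.updates d X k t_arr t_del \<epsilon> heap_cost calls lifetime_clustering.initial_state s c"
    for M :: "'a set" and d X k t_arr t_del \<epsilon> n calls s c
  proof -
    interpret lifetime_clustering M d X k t_arr t_del \<epsilon> heap_cost by (fact lc)
    define m where "m = Max (range (\<lambda>t. log 2 (real (card (active t)))))"
    define y where "y = log 2 aspect_ratio / \<epsilon>"
    have "finite (range active)"
      by (rule finite_subset[of _ "Pow X"]) (auto simp: active_def finite_X)
    then have "finite ((\<lambda>A. log 2 (real (card A))) ` range active)" by simp
    then have fin: "finite (range (\<lambda>t. log 2 (real (card (active t)))))" by (simp add: image_image)
    have m: "log 2 (real (card (active t))) \<le> m" for t unfolding m_def using fin by (intro Max_ge) auto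
    \<comment> \<open>For \<open>a = 0\<close> this rests on the default
      \<open>ln 0 = 0\<close>.\<close>
    have "log 2 (real a) \<ge> 0" for a :: nat by (cases "a = 0") (auto simp: log_def)
    then have m_nonneg: "m \<ge> 0" using order_trans[OF _ m] by blast
    define H where "H = nat \<lfloor>h0 * m + real h1\<rfloor>"
    have H: "heap_cost (card Q) \<le> H" if "Q \<subseteq> active t" "Q \<noteq> {}" for t Q
    proof -
      have "finite Q" using that finite_active finite_subset by blast
      then have Q: "card Q \<ge> 1" "card Q \<le> card (active t)"
        using that finite_active by (auto simp: Suc_le_eq card_gt_0_iff intro: card_mono)
      then have "log 2 (real (card Q)) \<le> log 2 (real (card (active t)))" by simp
      then have "log 2 (real (card Q)) \<le> m" by (rule order_trans[OF _ m])
      then have "h0 * log 2 (real (card Q)) \<le> h0 * m" using h0 by simp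
      then have "real (heap_cost (card Q)) \<le> h0 * m + real h1" using heap[OF Q(1)] by linarith
      then show ?thesis unfolding H_def by (rule le_nat_floor)
    qed
    have "c \<le> n * (3 + 2 * H + 50 * card \<Gamma> * k)"
      using operations_le[OF calls(1,3)] H calls(2) by blast
    then have "real c \<le> real (n * (3 + 2 * H + 50 * card \<Gamma> * k))" by (simp only: of_nat_le_iff)
    then have 1: "real c \<le> real n * (3 + 2 * real H + 50 * real (card \<Gamma>) * real k)" by simp
    have H_le: "real H \<le> h0 * m + real h1" unfolding H_def using h0 m_nonneg by (intro of_nat_floor) simp
    have "y0 \<le> y" unfolding y0_def y_def using assms eps eps_pos asp
      by (intro frac_le) auto
    then have y: "1 \<le> y / y0" "y > 0" using y0 by auto
    have "real (card \<Gamma>) \<le> (2 + \<epsilon>\<^sub>0) * y + 3"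
      using card_\<Gamma>_le[OF _ eps] asp assms(3) unfolding y_def by simp
    also have "\<dots> \<le> (2 + \<epsilon>\<^sub>0) * y + 3 * (y / y0)" using y by simp
    also have "\<dots> = (2 + \<epsilon>\<^sub>0 + 3 / y0) * y" by (simp add: algebra_simps)
    finally have \<Gamma>: "real (card \<Gamma>) * real k \<le> (2 + \<epsilon>\<^sub>0 + 3 / y0) * y * real k"
      by (intro mult_right_mono) auto
    \<comment> \<open>This factor absorbs the constants of a call and of small heaps into the term
      with \<open>k\<close>.\<close>
    have "1 \<le> (y / y0) * real k"
      using mult_mono[of 1 "y / y0" 1 "real k"] y k_pos by simp
    then have "(3 + 2 * real h1) * 1 \<le> (3 + 2 * real h1) * ((y / y0) * real k)"
      by (intro mult_left_mono) auto
    then have "3 + 2 * real h1 \<le> (3 + 2 * real h1) / y0 * (y * real k)" by simp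
    then have "3 + 2 * real H + 50 * real (card \<Gamma>) * real k
        \<le> 2 * h0 * m + (3 + 2 * real h1) / y0 * (y * real k) + 50 * ((2 + \<epsilon>\<^sub>0 + 3 / y0) * y * real k)"
      using H_le \<Gamma> by linarith
    also have "\<dots> = 2 * h0 * m + (50 * (2 + \<epsilon>\<^sub>0 + 3 / y0) + (3 + 2 * real h1) / y0) * (y * real k)"
      by (simp only: distrib_right mult.assoc)
    also have "\<dots> \<le> K * m + K * (y * real k)"
      using K m_nonneg y by (intro add_mono mult_right_mono) auto
    finally have "3 + 2 * real H + 50 * real (card \<Gamma>) * real k \<le> K * (m + y * real k)"
      by (simp add: algebra_simps)
    then have "real n * (3 + 2 * real H + 50 * real (card \<Gamma>) * real k) \<le> real n * (K * (m + y * real k))"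
      by (intro mult_left_mono) auto
    with 1 show ?thesis unfolding m_def y_def by (simp add: algebra_simps)
  qed
  ultimately show ?thesis by blast
qed

end
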